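(* Let $\mu$ be a real number with $1/2<\mu\le 1$. If $\pi\in\operatorname{Allow}(T_\mu)$, then $\pi\in\operatorname{Allow}(T)$.
   Context: For $0<\mu\le 1$, the symmetric tent map of height $\mu$ is $T_\mu:[0,1]\to[0,1]$, $T_\mu(x)=2\mu x$ if $0\le x\le 1/2$ and $T_\mu(x)=2\mu(1-x)$ if $1/2<x\le 1$. Write $T=T_1$. For a map $f:[0,1]\to[0,1]$, $f^k$ denotes the $k$-fold iterate ($f^0$ the identity). For $n\ge 1$ and $x\in[0,1]$ such that $x,f(x),\dots,f^{n-1}(x)$ are pairwise distinct, $\operatorname{Pat}(x,f,n)$ is the permutation $\pi=\pi_1\pi_2\cdots\pi_n$ of $\{1,\dots,n\}$ (one-line notation) whose entries are in the same relative order as $x,f(x),\dots,f^{n-1}(x)$, i.e. $\pi_i<\pi_j$ if and only if $f^{i-1}(x)<f^{j-1}(x)$. $\operatorname{Allow}_n(f)$ is the set of all permutations of $\{1,\dots,n\}$ of the form $\operatorname{Pat}(x,f,n)$ for some $x\in[0,1]$, and $\operatorname{Allow}(f)=\bigcup_{n\ge1}\operatorname{Allow}_n(f)$. *)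

theory Defs
  imports Complex_Main "HOL-Combinatorics.Multiset_Permutations"
begin

text \<open>The tent map of height \<open>\<mu>\<close>. Self-maps of \<open>[0,1]\<close> are represented by functions on the reals;
  only their values on \<open>[0,1]\<close> are used below (see \<open>tent_maps_to\<close>).\<close>

definition tent :: "real \<Rightarrow> real \<Rightarrow> real" where
  "tent \<mu> x = (if x \<le> 1/2 then 2 * \<mu> * x else 2 * \<mu> * (1 - x))"

definition orbit_distinct :: "real \<Rightarrow> (real \<Rightarrow> real) \<Rightarrow> nat \<Rightarrow> bool" where
  "orbit_distinct x f n \<longleftrightarrow> inj_on (\<lambda>i. (f ^^ i) x) {..<n}"

text \<open>A permutation \<open>\<pi>\<^sub>1 \<dots> \<pi>\<^sub>n\<close> of \<open>{1..n}\<close> in one-line notation is the list of its entries, so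
  the entry \<open>\<pi>\<^sub>i\<close> is \<open>\<pi> ! (i - 1)\<close>. Lists are used rather than functions satisfying
  \<open>permutes\<close> because the latter would identify permutations of different lengths.
  The description is only meaningful under \<open>orbit_distinct x f n\<close> (see \<open>Pat_ex1\<close>).\<close>

definition Pat :: "real \<Rightarrow> (real \<Rightarrow> real) \<Rightarrow> nat \<Rightarrow> nat list" where
  "Pat x f n = (THE \<pi>. \<pi> \<in> permutations_of_set {1..n} \<and>
     (\<forall>i<n. \<forall>j<n. \<pi> ! i < \<pi> ! j \<longleftrightarrow> (f ^^ i) x < (f ^^ j) x))"

definition Allow_n :: "nat \<Rightarrow> (real \<Rightarrow> real) \<Rightarrow> nat list set" where
  "Allow_n n f = {Pat x f n | x. x \<in> {0..1} \<and> orbit_distinct x f n}"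

definition Allow :: "(real \<Rightarrow> real) \<Rightarrow> nat list set" where
  "Allow f = (\<Union>n\<in>{1..}. Allow_n n f)"

lemma tent_maps_to:
  assumes "0 < \<mu>" "\<mu> \<le> 1" "x \<in> {0..1}"
  shows "tent \<mu> x \<in> {0..1}"
proof -
  have *: "2 * \<mu> * y \<in> {0..1}" if "0 \<le> y" "y \<le> 1/2" for y
    using mult_mono[of \<mu> 1 y "1/2"] assms that by auto
  show ?thesis
    using *[of x] *[of "1 - x"] assms(3) by (auto simp: tent_def)
qed

lemma Pat_ex1:
  assumes "orbit_distinct x f n"
  shows "\<exists>!\<pi>. \<pi> \<in> permutations_of_set {1..n} \<and>
     (\<forall>i<n. \<forall>j<n. \<pi> ! i < \<pi> ! j \<longleftrightarrow> (f ^^ i) x < (f ^^ j) x)"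
proof (rule ex_ex1I)
  define g where "g i = (f ^^ i) x" for i
  define r where "r i = card {k. k < n \<and> g k \<le> g i}" for i
  have less: "r i < r j" if "g i < g j" "j < n" for i j
  proof -
    have "{k. k < n \<and> g k \<le> g i} \<subseteq> {k. k < n \<and> g k \<le> g j}"
      using that(1) by (blast intro: order_trans less_imp_le)
    moreover have "j \<in> {k. k < n \<and> g k \<le> g j}" "j \<notin> {k. k < n \<and> g k \<le> g i}"
      using that by simp_all
    ultimately show ?thesis
      unfolding r_def by (intro psubset_card_mono) (simp, blast)
  qed
  have rle: "r i \<le> r j" if "g i \<le> g j" for i j
    unfolding r_def by (rule card_mono) (use that in auto)
  have iff: "r i < r j \<longleftrightarrow> g i < g j" if "i < n" "j < n" for i j
    using less[of i j] rle[of j i] that by linarith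
  have inj: "inj_on r {..<n}"
  proof (rule inj_onI)
    fix i j assume ij: "i \<in> {..<n}" "j \<in> {..<n}" "r i = r j"
    then have "g i = g j"
      using less[of i j] less[of j i] by (metis lessThan_iff less_irrefl linorder_neqE)
    then show "i = j"
      using assms ij by (auto simp: orbit_distinct_def g_def inj_on_def)
  qed
  have sub: "r ` {..<n} \<subseteq> {1..n}"
  proof
    fix y assume "y \<in> r ` {..<n}"
    then obtain i where i: "i < n" "y = r i" by auto
    have "card {i} \<le> r i" unfolding r_def by (rule card_mono) (use i in auto)
    moreover have "r i \<le> card {..<n}" unfolding r_def by (rule card_mono) auto
    ultimately show "y \<in> {1..n}" using i by auto
  qed
  have "r ` {..<n} = {1..n}"
    by (rule card_subset_eq) (use sub inj in \<open>auto simp: card_image\<close>)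
  then have "map r [0..<n] \<in> permutations_of_set {1..n}"
    using inj by (auto simp: permutations_of_set_def distinct_map atLeast0LessThan)
  moreover have "\<forall>i<n. \<forall>j<n. map r [0..<n] ! i < map r [0..<n] ! j \<longleftrightarrow> (f ^^ i) x < (f ^^ j) x"
    using iff by (simp add: g_def)
  ultimately show "\<exists>\<pi>. \<pi> \<in> permutations_of_set {1..n} \<and>
     (\<forall>i<n. \<forall>j<n. \<pi> ! i < \<pi> ! j \<longleftrightarrow> (f ^^ i) x < (f ^^ j) x)" by blast
next
  have rank: "\<pi> ! i = card {k. k < n \<and> \<pi> ! k \<le> \<pi> ! i}"
    if "\<pi> \<in> permutations_of_set {1..n}" "i < n" for \<pi> :: "nat list" and i
  proof -
    have d: "distinct \<pi>" "set \<pi> = {1..n}" "length \<pi> = n"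
      using that length_finite_permutations_of_set[of \<pi> "{1..n}"]
      by (simp_all add: permutations_of_set_def)
    have "(\<lambda>k. \<pi> ! k) ` {k. k < n \<and> \<pi> ! k \<le> \<pi> ! i} = {y \<in> set \<pi>. y \<le> \<pi> ! i}"
      using d(3) by (auto simp: in_set_conv_nth)
    also have "\<dots> = {1..\<pi> ! i}"
      using d nth_mem[of i \<pi>] that by auto
    finally have "card ((\<lambda>k. \<pi> ! k) ` {k. k < n \<and> \<pi> ! k \<le> \<pi> ! i}) = \<pi> ! i" by simp
    moreover have "inj_on (\<lambda>k. \<pi> ! k) {k. k < n \<and> \<pi> ! k \<le> \<pi> ! i}"
      using d by (auto simp: inj_on_def nth_eq_iff_index_eq)
    ultimately show ?thesis by (simp add: card_image)
  qed
  fix \<pi> \<sigma> :: "nat list"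
  assume p: "\<pi> \<in> permutations_of_set {1..n} \<and>
     (\<forall>i<n. \<forall>j<n. \<pi> ! i < \<pi> ! j \<longleftrightarrow> (f ^^ i) x < (f ^^ j) x)"
    and s: "\<sigma> \<in> permutations_of_set {1..n} \<and>
     (\<forall>i<n. \<forall>j<n. \<sigma> ! i < \<sigma> ! j \<longleftrightarrow> (f ^^ i) x < (f ^^ j) x)"
  show "\<pi> = \<sigma>"
  proof (rule nth_equalityI)
    have l: "length \<pi> = n" "length \<sigma> = n"
      using length_finite_permutations_of_set[OF conjunct1[OF p]]
        length_finite_permutations_of_set[OF conjunct1[OF s]] by simp_all
    then show "length \<pi> = length \<sigma>" by simp
    fix i assume "i < length \<pi>"
    then have i: "i < n" using l by simp
    have "\<pi> ! k \<le> \<pi> ! i \<longleftrightarrow> \<sigma> ! k \<le> \<sigma> ! i" if "k < n" for k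
      proof -
      have "\<pi> ! i < \<pi> ! k \<longleftrightarrow> (f ^^ i) x < (f ^^ k) x" using p i that by simp
      moreover have "\<sigma> ! i < \<sigma> ! k \<longleftrightarrow> (f ^^ i) x < (f ^^ k) x" using s i that by simp
      ultimately show ?thesis by linarith
    qed
    then have "{k. k < n \<and> \<pi> ! k \<le> \<pi> ! i} = {k. k < n \<and> \<sigma> ! k \<le> \<sigma> ! i}" by blast
    then show "\<pi> ! i = \<sigma> ! i"
      using rank[OF conjunct1[OF p] i] rank[OF conjunct1[OF s] i] by presburger
  qed
qed

end

(* Code a point by the T-point with the same left/right itinerary. Only a long finite prefix of the
   itinerary is followed, and the inverse branches of T are applied to the interior value 1/2, so
   points with different prefixes never collide at the turning point. Since T_mu has slope
   2 mu > 1 in absolute value, long prefixes separate the finitely many points of a given orbit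
   segment, and the coding preserves their order. *)
theory Submission imports Defs begin

primrec code_point :: "real \<Rightarrow> nat \<Rightarrow> real \<Rightarrow> real" where
  "code_point \<mu> 0 x = 1/2"
| "code_point \<mu> (Suc m) x =
     (if x \<le> 1/2 then code_point \<mu> m (tent \<mu> x) / 2 else 1 - code_point \<mu> m (tent \<mu> x) / 2)"

text \<open>Strictness is the point: codes of left points fall strictly below 1/2 and codes of right
  points strictly above it, so \<open>tent 1\<close> undoes the branch that was chosen.\<close>

lemma code_point_bounds: "0 < code_point \<mu> m x \<and> code_point \<mu> m x < 1"
proof (induction m arbitrary: x)
  case (Suc m)
  from Suc.IH[of "tent \<mu> x"] show ?case by auto
qed simp

lemma tent_code_point: "tent 1 (code_point \<mu> (Suc m) x) = code_point \<mu> m (tent \<mu> x)"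
  using code_point_bounds[of \<mu> m "tent \<mu> x"] by (simp add: tent_def[of 1])

text \<open>Each step of \<open>tent 1\<close> consumes one itinerary symbol, so the orbit of a code
  consists of codes of the original orbit, at decreasing depths.\<close>

lemma tent_funpow_code_point:
  "(tent 1 ^^ i) (code_point \<mu> (m + i) x) = code_point \<mu> m ((tent \<mu> ^^ i) x)"
proof (induction i arbitrary: m)
  case (Suc i)
  have "(tent 1 ^^ Suc i) (code_point \<mu> (m + Suc i) x)
      = tent 1 ((tent 1 ^^ i) (code_point \<mu> (Suc m + i) x))" by simp
  also have "\<dots> = tent 1 (code_point \<mu> (Suc m) ((tent \<mu> ^^ i) x))"
    by (simp only: Suc.IH)
  also have "\<dots> = code_point \<mu> m ((tent \<mu> ^^ Suc i) x)"
    by (simp only: tent_code_point funpow.simps comp_def)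
  finally show ?case .
qed simp

lemma tent_funpow_maps_to:
  assumes "0 < \<mu>" "\<mu> \<le> 1" "x \<in> {0..1}"
  shows "(tent \<mu> ^^ i) x \<in> {0..1}"
  using assms tent_maps_to by (induction i) auto

text \<open>While two points lie on the same side of 1/2, each step stretches their gap by
  \<open>2 * \<mu>\<close>. Since a gap never exceeds 1, they are separated by the turning point
  within \<open>K\<close> symbols, and both codes are deep enough to record this. The depths
  \<open>m\<close> and \<open>m'\<close> differ because the codes of two orbit points have different
  depths.\<close>

lemma code_point_less:
  assumes "0 < \<mu>" "\<mu> \<le> 1" "a \<in> {0..1}" "b \<in> {0..1}" "a < b"
    and "1 < (2 * \<mu>) ^ K * (b - a)" "K \<le> m" "K \<le> m'"
  shows "code_point \<mu> m a < code_point \<mu> m' b"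
  using assms(3-)
proof (induction K arbitrary: a b m m')
  case 0
  \<comment> \<open>The gap would exceed 1, which is impossible in the unit interval.\<close>
  then show ?case by simp
next
  case (Suc K)
  obtain p q where pq: "m = Suc p" "m' = Suc q" "K \<le> p" "K \<le> q"
    using Suc.prems by (metis Suc_le_D Suc_le_mono)
  have maps: "tent \<mu> a \<in> {0..1}" "tent \<mu> b \<in> {0..1}"
    using assms(1,2) Suc.prems tent_maps_to by blast+
  have pos: "0 < 2 * \<mu> * (b - a)"
    using assms(1) Suc.prems by simp
  have big: "1 < (2 * \<mu>) ^ K * (2 * \<mu> * (b - a))"
    using Suc.prems(4) by (simp only: power_Suc mult_ac)
  consider "b \<le> 1/2" | "a \<le> 1/2" "1/2 < b" | "1/2 < a" by linarith
  then show ?case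
  proof cases
    case 1
    then have d: "tent \<mu> b - tent \<mu> a = 2 * \<mu> * (b - a)"
      using Suc.prems by (simp add: tent_def algebra_simps)
    have "code_point \<mu> p (tent \<mu> a) < code_point \<mu> q (tent \<mu> b)"
      by (rule Suc.IH) (use maps pos big pq d in auto)
    with 1 Suc.prems pq show ?thesis by simp
  next
    case 2
    then show ?thesis
      using code_point_bounds[of \<mu> p "tent \<mu> a"] code_point_bounds[of \<mu> q "tent \<mu> b"] pq by simp
  next
    case 3
    then have d: "tent \<mu> a - tent \<mu> b = 2 * \<mu> * (b - a)"
      using Suc.prems by (simp add: tent_def algebra_simps)
    \<comment> \<open>The right branch and its inverse both reverse order, so the induction
      hypothesis is used with the points and depths exchanged.\<close>
    have "code_point \<mu> q (tent \<mu> b) < code_point \<mu> p (tent \<mu> a)"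
      by (rule Suc.IH) (use maps pos big pq d in auto)
    with 3 Suc.prems pq show ?thesis by simp
  qed
qed

lemma ex_uniform_power:
  fixes c :: real
  assumes "1 < c" "finite D" "\<And>d. d \<in> D \<Longrightarrow> 0 < d"
  shows "\<exists>K. \<forall>d\<in>D. 1 < c ^ K * d"
proof (cases "D = {}")
  case False
  then have m: "0 < Min D"
    using assms by simp
  obtain K where K: "1 / Min D < c ^ K"
    using real_arch_pow[OF assms(1)] by blast
  have "1 < c ^ K * d" if "d \<in> D" for d
  proof -
    have "1 < c ^ K * Min D" using K m by (simp add: field_simps)
    also have "\<dots> \<le> c ^ K * d"
      using assms(1,2) that by (intro mult_left_mono) auto
    finally show ?thesis .
  qed
  then show ?thesis by blast
qed simp

text \<open>The description defining \<open>Pat\<close> sees the orbit only through these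
  comparisons.\<close>

lemma Pat_cong:
  assumes "\<And>i j. i < n \<Longrightarrow> j < n \<Longrightarrow> (f ^^ i) x < (f ^^ j) x \<longleftrightarrow> (g ^^ i) y < (g ^^ j) y"
  shows "Pat x f n = Pat y g n"
  unfolding Pat_def using assms by (intro arg_cong[where f = The] ext) auto

theorem theorem4p1:
  fixes \<mu> :: real and \<pi> :: "nat list"
  assumes "1/2 < \<mu>" and "\<mu> \<le> 1"
    and "\<pi> \<in> Allow (tent \<mu>)"
  shows "\<pi> \<in> Allow (tent 1)"
proof -
  obtain n x where n: "1 \<le> n" and x: "x \<in> {0..1}" and inj: "orbit_distinct x (tent \<mu>) n"
    and \<pi>: "\<pi> = Pat x (tent \<mu>) n"
    using assms(3) by (auto simp: Allow_def Allow_n_def)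
  define u where "u i = (tent \<mu> ^^ i) x" for i
  have u: "u i \<in> {0..1}" for i
    unfolding u_def using assms x by (intro tent_funpow_maps_to) auto
  \<comment> \<open>The positive gaps between orbit points: finitely many, so a single
    \<open>K\<close> serves all pairs.\<close>
  define D where "D = {d \<in> (\<lambda>(i, j). u j - u i) ` ({..<n} \<times> {..<n}). 0 < d}"
  have "finite D" "\<And>d. d \<in> D \<Longrightarrow> 0 < d"
    by (simp_all add: D_def)
  moreover have "1 < 2 * \<mu>"
    using assms(1) by simp
  ultimately obtain K where K: "\<forall>d\<in>D. 1 < (2 * \<mu>) ^ K * d"
    using ex_uniform_power by blast
  \<comment> \<open>The extra depth \<open>n\<close> ensures that at least \<open>K\<close> symbols
    remain after any \<open>i < n\<close> steps.\<close>
  define y where "y = code_point \<mu> (K + n) x"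
  have orbit: "(tent 1 ^^ i) y = code_point \<mu> (K + n - i) (u i)" if "i < n" for i
    using tent_funpow_code_point[of i \<mu> "K + n - i" x] that by (simp add: y_def u_def)
  have less: "(tent 1 ^^ i) y < (tent 1 ^^ j) y" if "i < n" "j < n" "u i < u j" for i j
  proof -
    have "u j - u i \<in> D" using that by (auto simp: D_def)
    then have "1 < (2 * \<mu>) ^ K * (u j - u i)" using K by blast
    then have "code_point \<mu> (K + n - i) (u i) < code_point \<mu> (K + n - j) (u j)"
      by (intro code_point_less[where K = K]) (use that assms(1,2) u[of i] u[of j] in simp_all)
    then show ?thesis
      by (simp only: orbit that)
  qed
  have neq: "u i \<noteq> u j" if "i < n" "j < n" "i \<noteq> j" for i j
    using inj that by (auto simp: orbit_distinct_def inj_on_def u_def)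
  \<comment> \<open>The converse of \<open>less\<close> comes from exchanging \<open>i\<close> and
    \<open>j\<close>, as \<open>neq\<close> excludes ties.\<close>
  have iff: "(tent \<mu> ^^ i) x < (tent \<mu> ^^ j) x \<longleftrightarrow> (tent 1 ^^ i) y < (tent 1 ^^ j) y"
    if "i < n" "j < n" for i j
    using less[of i j] less[of j i] neq[of i j] that unfolding u_def by fastforce
  have "orbit_distinct y (tent 1) n"
    unfolding orbit_distinct_def
  proof (rule linorder_inj_onI)
    fix i j assume "i < j" "i \<in> {..<n}" "j \<in> {..<n}"
    then show "(tent 1 ^^ i) y \<noteq> (tent 1 ^^ j) y"
      using less[of i j] less[of j i] neq[of i j] by (cases "u i < u j") auto
  qed auto
  moreover have "y \<in> {0..1}"
    using code_point_bounds[of \<mu> "K + n" x] by (auto simp: y_def)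
  moreover have "\<pi> = Pat y (tent 1) n"
    unfolding \<pi> using iff by (rule Pat_cong)
  ultimately show ?thesis
    using n by (auto simp: Allow_def Allow_n_def)
qed

end
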